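(* Let $GAL(1,3)$ be the full isometry group of the Newton-Cartan spacetime, generated by parity inversion $P$, time reversal $T$, the spatial rotations, the Galilean boosts, and the group $\mathcal{T}$ of space and time translations. Let $\mathcal{L}$ be the subgroup generated by $P$, $T$, the spatial rotations and the Galilean boosts. Then: (a) $GAL(1,3)$ is an outer semidirect product of $\mathcal{T}$ (normal factor) and $\mathcal{L}$, that is, $GAL(1,3)=\mathcal{T}\rtimes\mathcal{L}$. (b) The direct isometries of $\mathcal{L}$ are direct isometries of $GAL(1,3)$. (c) The indirect isometries of $\mathcal{L}$ are indirect isometries of $GAL(1,3)$.
   Context: Elements of the Newton-Cartan spacetime are denoted $(t,x)$ with $t\in\mathbb{R}$ (time) and $x\in\mathbb{R}^3$ (space). Parity inversion is $P:(t,x)\mapsto(t,-x)$, time reversal is $T:(t,x)\mapsto(-t,x)$, spatial rotations are the maps $(t,x)\mapsto(t,Rx)$ with $R\in SO(3)$, Galilean boosts are the maps $b_v:(t,x)\mapsto(t,x+tv)$ with $v\in\mathbb{R}^3$, and space and time translations are the maps $(t,x)\mapsto(t+s,x+z)$ with $s\in\mathbb{R}$, $z\in\mathbb{R}^3$. In the semidirect product, $\mathcal{L}$ acts on $\mathcal{T}$ by conjugation, and elements of the factors are identified with their images in the product. An element of an isometry group $\Gamma$ is called a direct isometry of $\Gamma$ when it can be expressed as a (finite) product of squares of elements of $\Gamma$; otherwise it is an indirect isometry of $\Gamma$. *)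

theory Defs
  imports "HOL-Analysis.Analysis" "HOL-Algebra.Bij" "HOL-Algebra.Coset"
    "HOL-Algebra.Generated_Groups"
begin

section \<open>Outer semidirect products\<close>

definition semidirect_product ::
    "('a, 'm) monoid_scheme \<Rightarrow> ('b, 'n) monoid_scheme \<Rightarrow> ('b \<Rightarrow> 'a \<Rightarrow> 'a) \<Rightarrow> ('a \<times> 'b) monoid"
  where "semidirect_product N H \<phi> =
    \<lparr>carrier = carrier N \<times> carrier H,
     mult = (\<lambda>(n, h) (n', h'). (n \<otimes>\<^bsub>N\<^esub> \<phi> h n', h \<otimes>\<^bsub>H\<^esub> h')),
     one = (\<one>\<^bsub>N\<^esub>, \<one>\<^bsub>H\<^esub>)\<rparr>"

text \<open>The conjugation maps are restricted to \<open>N\<close> because the elements of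
  \<^const>\<open>AutoGroup\<close> are extensional functions.\<close>

definition conj_action :: "('a, 'm) monoid_scheme \<Rightarrow> 'a set \<Rightarrow> 'a \<Rightarrow> 'a \<Rightarrow> 'a"
  where "conj_action G N h = (\<lambda>n\<in>N. h \<otimes>\<^bsub>G\<^esub> n \<otimes>\<^bsub>G\<^esub> inv\<^bsub>G\<^esub> h)"


section \<open>Direct and indirect isometries\<close>

definition direct_isometry :: "('a, 'm) monoid_scheme \<Rightarrow> 'a \<Rightarrow> bool"
  where "direct_isometry G g \<longleftrightarrow>
    (\<exists>xs. set xs \<subseteq> carrier G \<and> g = foldr (\<lambda>x y. (x \<otimes>\<^bsub>G\<^esub> x) \<otimes>\<^bsub>G\<^esub> y) xs \<one>\<^bsub>G\<^esub>)"

definition indirect_isometry :: "('a, 'm) monoid_scheme \<Rightarrow> 'a \<Rightarrow> bool"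
  where "indirect_isometry G g \<longleftrightarrow> g \<in> carrier G \<and> \<not> direct_isometry G g"


section \<open>The isometry group of the Newton-Cartan spacetime\<close>

type_synonym spacetime = "real \<times> (real ^ 3)"

definition parity_inversion :: "spacetime \<Rightarrow> spacetime"
  where "parity_inversion = (\<lambda>(t, x). (t, - x))"

definition time_reversal :: "spacetime \<Rightarrow> spacetime"
  where "time_reversal = (\<lambda>(t, x). (- t, x))"

definition spatial_rotation :: "real ^ 3 ^ 3 \<Rightarrow> spacetime \<Rightarrow> spacetime"
  where "spatial_rotation R = (\<lambda>(t, x). (t, R *v x))"

definition boost :: "real ^ 3 \<Rightarrow> spacetime \<Rightarrow> spacetime"
  where "boost v = (\<lambda>(t, x). (t, x + t *\<^sub>R v))"

definition translation :: "real \<Rightarrow> real ^ 3 \<Rightarrow> spacetime \<Rightarrow> spacetime"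
  where "translation s z = (\<lambda>(t, x). (t + s, x + z))"

definition spacetime_translations :: "(spacetime \<Rightarrow> spacetime) set"
  where "spacetime_translations = {translation s z | s z. True}"

definition homogeneous_generators :: "(spacetime \<Rightarrow> spacetime) set"
  where "homogeneous_generators =
    {parity_inversion, time_reversal}
    \<union> {spatial_rotation R | R. rotation_matrix R}
    \<union> {boost v | v. True}"

definition GAL :: "(spacetime \<Rightarrow> spacetime) monoid"
  where "GAL = (BijGroup UNIV)
    \<lparr>carrier := generate (BijGroup UNIV) (homogeneous_generators \<union> spacetime_translations)\<rparr>"

definition Translation_group :: "(spacetime \<Rightarrow> spacetime) monoid"
  where "Translation_group = GAL\<lparr>carrier := spacetime_translations\<rparr>"

definition Homogeneous_group :: "(spacetime \<Rightarrow> spacetime) monoid"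
  where "Homogeneous_group = GAL\<lparr>carrier := generate GAL homogeneous_generators\<rparr>"

end

theory Submission
  imports Defs "HOL-Algebra.SndIsomorphismGrp"
begin

text \<open>Every element of the group is affine, so conjugation maps a translation to the translation
  by the image under the linear part. Homogeneous isometries fix the origin, which a nontrivial
  translation moves; hence the two subgroups meet trivially and the product is semidirect.
  Taking the homogeneous factor is then a retraction of the whole group onto \<open>\<L>\<close> that maps
  products of squares to products of squares. This is why an element of \<open>\<L>\<close> that is direct in the
  whole group is already direct in \<open>\<L>\<close>.\<close>

section \<open>Products of squares in a group and its subgroups\<close>

lemma direct_isometry_mono:
  assumes "direct_isometry (G\<lparr>carrier := S\<rparr>) g" "S \<subseteq> carrier G"
  shows "direct_isometry G g"
  using assms unfolding direct_isometry_def by auto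

lemma direct_isometry_one: "direct_isometry G \<one>\<^bsub>G\<^esub>"
  unfolding direct_isometry_def by (rule exI[of _ "[]"]) simp

lemma direct_isometry_square_mult:
  assumes "x \<in> carrier G" "direct_isometry G g"
  shows "direct_isometry G (x \<otimes>\<^bsub>G\<^esub> x \<otimes>\<^bsub>G\<^esub> g)"
proof -
  from assms(2) obtain xs where xs: "set xs \<subseteq> carrier G"
    "g = foldr (\<lambda>x y. (x \<otimes>\<^bsub>G\<^esub> x) \<otimes>\<^bsub>G\<^esub> y) xs \<one>\<^bsub>G\<^esub>"
    unfolding direct_isometry_def by blast
  show ?thesis
    unfolding direct_isometry_def by (rule exI[of _ "x # xs"]) (use xs assms(1) in simp)
qed

section \<open>Internal semidirect products: a normal subgroup \<open>H\<close> with complement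
  \<open>S\<close>\<close>

locale internal_semidirect_product = second_isomorphism_grp +
  assumes trivial_intersection: "H \<inter> S = {\<one>}"
    and set_mult_eq_carrier: "H <#> S = carrier G"
begin

lemma S_in_carrier [simp]: "s \<in> S \<Longrightarrow> s \<in> carrier G"
  using subgrpS by (rule subgroup.mem_carrier)

lemma factorization:
  assumes "g \<in> carrier G"
  obtains n s where "n \<in> H" "s \<in> S" "g = n \<otimes> s"
  using assms set_mult_eq_carrier unfolding set_mult_def by blast

text \<open>Equal products give \<open>inv n' \<otimes> n = s' \<otimes> inv s\<close>, an element
  of both \<open>H\<close> and \<open>S\<close>, hence \<open>\<one>\<close>.\<close>

lemma factorization_unique:
  assumes "n \<in> H" "s \<in> S" "n' \<in> H" "s' \<in> S" "n \<otimes> s = n' \<otimes> s'"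
  shows "n = n' \<and> s = s'"
proof -
  have eq: "inv n' \<otimes> n = s' \<otimes> inv s"
    using assms by (metis S_in_carrier inv_closed inv_solve_left inv_solve_right m_assoc m_closed mem_carrier)
  have "inv n' \<otimes> n \<in> H" "s' \<otimes> inv s \<in> S"
    using assms subgrpS by (auto simp: subgroup.m_closed subgroup.m_inv_closed)
  then have "inv n' \<otimes> n = \<one>" "s' \<otimes> inv s = \<one>"
    using eq trivial_intersection by auto
  then show ?thesis
    using assms by (metis S_in_carrier inv_closed inv_equality inv_inv mem_carrier)
qed

lemma conj_action_closed:
  assumes "s \<in> S" "n \<in> H"
  shows "conj_action G H s n \<in> H"
  using assms by (simp add: conj_action_def inv_op_closed2)

lemma conj_action_mult:
  assumes "s \<in> S" "s' \<in> S" "n \<in> H"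
  shows "conj_action G H (s \<otimes> s') n = conj_action G H s (conj_action G H s' n)"
proof -
  \<comment> \<open>The outer map is restricted to \<open>H\<close>, so it unfolds to a conjugation
    only once its argument is known to lie there.\<close>
  have "s' \<otimes> n \<otimes> inv s' \<in> H"
    using assms by (simp add: inv_op_closed2)
  then show ?thesis
    using assms by (simp add: conj_action_def inv_mult_group m_assoc)
qed

lemma conj_action_one: "n \<in> H \<Longrightarrow> conj_action G H \<one> n = n"
  by (simp add: conj_action_def)

text \<open>Moving \<open>s\<close> to the right past \<open>n'\<close> replaces \<open>n'\<close>
  by its conjugate. The right-hand side is the multiplication rule of the outer semidirect
  product.\<close>

lemma factorization_mult:
  assumes "n \<in> H" "s \<in> S" "n' \<in> H" "s' \<in> S"
  shows "(n \<otimes> s) \<otimes> (n' \<otimes> s') = (n \<otimes> conj_action G H s n') \<otimes> (s \<otimes> s')"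
proof -
  have "inv s \<otimes> (s \<otimes> s') = s'"
    using assms by (simp flip: m_assoc)
  then show ?thesis
    using assms by (simp add: conj_action_def m_assoc)
qed

text \<open>Conjugation by \<open>inv s\<close> is the two-sided inverse on \<open>H\<close>.
  Membership in \<open>auto\<close> also demands extensionality, which the restriction in
  \<open>conj_action\<close> provides.\<close>

lemma conj_action_in_auto:
  assumes "s \<in> S"
  shows "conj_action G H s \<in> auto (G\<lparr>carrier := H\<rparr>)"
proof -
  have s': "inv s \<in> S"
    using assms subgrpS by (simp add: subgroup.m_inv_closed)
  have "conj_action G H s (conj_action G H (inv s) n) = n"
    "conj_action G H (inv s) (conj_action G H s n) = n" if "n \<in> H" for n
    using conj_action_mult[OF assms s' that] conj_action_mult[OF s' assms that] assms that
    by (simp_all add: conj_action_one)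
  then have "bij_betw (conj_action G H s) H H"
    using assms s' by (intro bij_betwI[where g = "conj_action G H (inv s)"])
      (auto simp: conj_action_closed)
  moreover have "conj_action G H s (n \<otimes> n') = conj_action G H s n \<otimes> conj_action G H s n'"
    if "n \<in> H" "n' \<in> H" for n n'
  proof -
    have "inv s \<otimes> (s \<otimes> (n' \<otimes> inv s)) = n' \<otimes> inv s"
      using assms that by (simp flip: m_assoc)
    then show ?thesis
      using assms that by (simp add: conj_action_def m_assoc)
  qed
  ultimately show ?thesis
    using assms by (auto simp: auto_def Bij_def hom_def conj_action_closed)
      (simp add: conj_action_def)
qed

lemma conj_action_hom:
  "conj_action G H \<in> hom (G\<lparr>carrier := S\<rparr>) (AutoGroup (G\<lparr>carrier := H\<rparr>))"
proof (rule homI)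
  show "conj_action G H s \<in> carrier (AutoGroup (G\<lparr>carrier := H\<rparr>))"
    if "s \<in> carrier (G\<lparr>carrier := S\<rparr>)" for s
    using that conj_action_in_auto by (simp add: AutoGroup_def)
next
  fix s s' assume "s \<in> carrier (G\<lparr>carrier := S\<rparr>)" "s' \<in> carrier (G\<lparr>carrier := S\<rparr>)"
  then have ss: "s \<in> S" "s' \<in> S" by simp_all
  \<comment> \<open>\<open>AutoGroup\<close> multiplies by \<open>compose\<close> on
    \<open>H\<close>, so the equation is needed on the whole type; outside \<open>H\<close> both
    sides are \<open>undefined\<close>.\<close>
  have "conj_action G H (s \<otimes> s') = compose H (conj_action G H s) (conj_action G H s')"
  proof
    fix n show "conj_action G H (s \<otimes> s') n = compose H (conj_action G H s) (conj_action G H s') n"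
    proof (cases "n \<in> H")
      case True
      then show ?thesis using ss by (simp add: compose_def conj_action_mult)
    next
      case False
      then show ?thesis by (simp add: compose_def conj_action_def)
    qed
  qed
  then show "conj_action G H (s \<otimes>\<^bsub>G\<lparr>carrier := S\<rparr>\<^esub> s') =
      conj_action G H s \<otimes>\<^bsub>AutoGroup (G\<lparr>carrier := H\<rparr>)\<^esub> conj_action G H s'"
    using ss conj_action_in_auto by (simp add: AutoGroup_def BijGroup_def auto_def)
qed

text \<open>Injectivity is uniqueness of the factorization, surjectivity its existence, and
  compatibility with products is \<open>factorization_mult\<close>.\<close>

lemma semidirect_product_iso:
  "(\<lambda>(n, s). n \<otimes> s) \<in>
    iso (semidirect_product (G\<lparr>carrier := H\<rparr>) (G\<lparr>carrier := S\<rparr>) (conj_action G H)) G"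
proof -
  have "inj_on (\<lambda>(n, s). n \<otimes> s) (H \<times> S)"
    by (auto intro!: inj_onI dest: factorization_unique)
  moreover have "(\<lambda>(n, s). n \<otimes> s) ` (H \<times> S) = H <#> S"
    by (auto simp: set_mult_def image_iff)
  ultimately show ?thesis
    by (auto simp: iso_def hom_def bij_betw_def semidirect_product_def factorization_mult set_mult_eq_carrier)
qed

text \<open>The retraction is not defined as a map: the induction over the list of square roots
  carries along some factorization whose \<open>S\<close>-factor is direct in
  \<open>S\<close>.\<close>

lemma direct_isometry_retract:
  assumes "direct_isometry G g" "g \<in> S"
  shows "direct_isometry (G\<lparr>carrier := S\<rparr>) g"
proof -
  let ?fold = "\<lambda>xs. foldr (\<lambda>x y. (x \<otimes> x) \<otimes> y) xs \<one>"
  have "\<exists>n\<in>H. \<exists>s\<in>S. ?fold xs = n \<otimes> s \<and> direct_isometry (G\<lparr>carrier := S\<rparr>) s"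
    if "set xs \<subseteq> carrier G" for xs
    using that
  proof (induction xs)
    case Nil
    have "\<one> \<in> S" using subgrpS by (rule subgroup.one_closed)
    then show ?case
      using direct_isometry_one[of "G\<lparr>carrier := S\<rparr>"]
      by (intro bexI[of _ \<one>]) simp_all
  next
    case (Cons x xs)
    then obtain n s where ns: "n \<in> H" "s \<in> S" "?fold xs = n \<otimes> s"
      "direct_isometry (G\<lparr>carrier := S\<rparr>) s" by auto
    from Cons.prems obtain m r where mr: "m \<in> H" "r \<in> S" "x = m \<otimes> r"
      using factorization[of x] by auto
    have rr: "r \<otimes> r \<in> S" using mr subgrpS by (simp add: subgroup.m_closed)
    \<comment> \<open>The \<open>H\<close>-factor of \<open>x \<otimes> x\<close>; its
      \<open>S\<close>-factor is the square \<open>r \<otimes> r\<close>, which prolongs the product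
      of squares in \<open>S\<close>.\<close>
    define k where "k = m \<otimes> conj_action G H r m"
    have k: "k \<in> H" "x \<otimes> x = k \<otimes> (r \<otimes> r)"
      using mr by (simp_all add: k_def conj_action_closed factorization_mult)
    have "?fold (x # xs) = (k \<otimes> conj_action G H (r \<otimes> r) n) \<otimes> (r \<otimes> r \<otimes> s)"
      using k ns rr by (simp add: factorization_mult)
    moreover have "k \<otimes> conj_action G H (r \<otimes> r) n \<in> H"
      using k ns rr by (simp add: conj_action_closed)
    moreover have "r \<otimes> r \<otimes> s \<in> S"
      using rr ns subgrpS by (simp add: subgroup.m_closed)
    moreover have "direct_isometry (G\<lparr>carrier := S\<rparr>) (r \<otimes> r \<otimes> s)"
      using direct_isometry_square_mult[of r "G\<lparr>carrier := S\<rparr>" s] mr ns by simp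
    ultimately show ?case by blast
  qed
  moreover obtain xs where "set xs \<subseteq> carrier G" "g = ?fold xs"
    using assms(1) unfolding direct_isometry_def by blast
  ultimately obtain n s where ns: "n \<in> H" "s \<in> S" "g = n \<otimes> s"
    "direct_isometry (G\<lparr>carrier := S\<rparr>) s"
    by metis
  \<comment> \<open>Since \<open>g\<close> lies in \<open>S\<close>, it also factors with trivial
    \<open>H\<close>-factor; comparing the two factorizations gives \<open>g = s\<close>.\<close>
  then have "\<one> \<otimes> g = n \<otimes> s"
    using assms(2) by simp
  then have "g = s"
    using factorization_unique[OF subgroup.one_closed[OF is_subgroup] assms(2) ns(1,2)] by simp
  then show ?thesis using ns by simp
qed

end

section \<open>Bijections of spacetime and the generators\<close>

lemma Bij_UNIV: "Bij UNIV = {f. bij f}"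
  by (auto simp: Bij_def)

lemma mult_BijGroup_UNIV:
  assumes "bij f" "bij g"
  shows "f \<otimes>\<^bsub>BijGroup UNIV\<^esub> g = f \<circ> g"
  using assms by (auto simp: BijGroup_def Bij_UNIV compose_def)

lemma inv_BijGroup_UNIV:
  assumes "bij f"
  shows "inv\<^bsub>BijGroup UNIV\<^esub> f = inv_into UNIV f"
  using assms by (auto simp: inv_BijGroup Bij_UNIV)

lemma translation_eq: "translation s z = (\<lambda>p. p + (s, z))"
  by (auto simp: translation_def)

text \<open>Spacetime is a product vector space, so time and space shifts merge into the addition of
  one vector.\<close>

lemma spacetime_translations_eq: "spacetime_translations = range (\<lambda>a p. p + a)"
  by (auto simp: spacetime_translations_def translation_eq)

text \<open>Linearity refers to the pair \<open>(t, x)\<close>: a boost adds a multiple of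
  \<open>t\<close> to \<open>x\<close>, which is linear in both coordinates jointly.\<close>

lemma homogeneous_generators_linear:
  assumes "f \<in> homogeneous_generators"
  shows "linear f"
proof -
  have "linear parity_inversion" "linear time_reversal" "linear (boost v)"
    "linear (spatial_rotation R)" for v R
    by (auto intro!: linearI simp: parity_inversion_def time_reversal_def boost_def
        spatial_rotation_def matrix_vector_right_distrib matrix_vector_mult_scaleR algebra_simps)
  then show ?thesis
    using assms by (auto simp: homogeneous_generators_def)
qed

lemma homogeneous_generators_bij:
  assumes "f \<in> homogeneous_generators"
  shows "bij f"
proof -
  have "bij parity_inversion"
    by (rule o_bij[of parity_inversion]) (auto simp: parity_inversion_def)
  moreover have "bij time_reversal"
    by (rule o_bij[of time_reversal]) (auto simp: time_reversal_def)
  moreover have "bij (boost v)" for v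
    by (rule o_bij[of "boost (- v)"]) (auto simp: boost_def)
  \<comment> \<open>Orthogonality makes the transpose the inverse. Deleting
    \<open>transpose_matrix_vector\<close> keeps \<open>transpose R *v x\<close> in a form where the
    two matrices can be multiplied together.\<close>
  moreover have "bij (spatial_rotation R)" if "rotation_matrix R" for R
    by (rule o_bij[of "spatial_rotation (transpose R)"])
      (use that in \<open>auto simp: spatial_rotation_def rotation_matrix_def orthogonal_matrix_def
        matrix_vector_mul_assoc fun_eq_iff simp del: transpose_matrix_vector\<close>)
  ultimately show ?thesis
    using assms by (auto simp: homogeneous_generators_def)
qed

lemma spacetime_translations_bij:
  assumes "f \<in> spacetime_translations"
  shows "bij f"
  using assms by (auto simp: spacetime_translations_eq bij_plus_right)

section \<open>The group \<open>GAL\<close> inside the group of all bijections\<close>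

interpretation bij_spacetime: group "BijGroup (UNIV :: spacetime set)"
  by (rule group_BijGroup)

lemma generators_subset_carrier:
  "homogeneous_generators \<union> spacetime_translations \<subseteq> carrier (BijGroup UNIV)"
  using homogeneous_generators_bij spacetime_translations_bij
  by (auto simp: BijGroup_def Bij_UNIV)

lemma subgroup_carrier_GAL: "subgroup (carrier GAL) (BijGroup UNIV)"
  using bij_spacetime.generate_is_subgroup[OF generators_subset_carrier] by (simp add: GAL_def)

interpretation GAL: group GAL
  using bij_spacetime.subgroup_imp_group[OF subgroup_carrier_GAL] by (simp add: GAL_def)

lemma carrier_GAL_bij: "f \<in> carrier GAL \<Longrightarrow> bij f"
  using subgroup.subset[OF subgroup_carrier_GAL] by (auto simp: BijGroup_def Bij_UNIV)

lemma one_GAL: "\<one>\<^bsub>GAL\<^esub> = id"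
  by (auto simp: GAL_def BijGroup_def)

lemma mult_GAL:
  assumes "f \<in> carrier GAL" "g \<in> carrier GAL"
  shows "f \<otimes>\<^bsub>GAL\<^esub> g = f \<circ> g"
  using carrier_GAL_bij[OF assms(1)] carrier_GAL_bij[OF assms(2)]
  by (simp add: GAL_def mult_BijGroup_UNIV)

lemma inv_GAL:
  assumes "f \<in> carrier GAL"
  shows "inv\<^bsub>GAL\<^esub> f = inv_into UNIV f"
proof -
  have "inv\<^bsub>GAL\<^esub> f = inv\<^bsub>BijGroup UNIV\<^esub> f"
    using bij_spacetime.m_inv_consistent[OF subgroup_carrier_GAL assms] by (simp add: GAL_def)
  then show ?thesis using assms by (simp add: carrier_GAL_bij inv_BijGroup_UNIV)
qed

lemma generators_in_GAL:
  "homogeneous_generators \<subseteq> carrier GAL" "spacetime_translations \<subseteq> carrier GAL"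
  by (auto simp: GAL_def intro: generate.incl)

text \<open>The definition generates inside \<open>BijGroup UNIV\<close>; generating inside
  \<open>GAL\<close> instead allows induction with the operations of \<open>GAL\<close>.\<close>

lemma carrier_GAL_eq:
  "carrier GAL = generate GAL (homogeneous_generators \<union> spacetime_translations)"
  using bij_spacetime.generate_consistent[OF _ subgroup_carrier_GAL] generators_in_GAL
  by (simp add: GAL_def)

lemma translation_in_GAL: "(\<lambda>p. p + a) \<in> carrier GAL"
  using generators_in_GAL by (auto simp: spacetime_translations_eq)

section \<open>Linear and affine parts; normality of the translations\<close>

lemma subgroup_homogeneous: "subgroup (generate GAL homogeneous_generators) GAL"
  by (rule GAL.generate_is_subgroup[OF generators_in_GAL(1)])

lemma subgroup_translations: "subgroup spacetime_translations GAL"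
proof (rule GAL.subgroupI)
  fix f assume "f \<in> spacetime_translations"
  then obtain a where f: "f = (\<lambda>p. p + a)" by (auto simp: spacetime_translations_eq)
  have "inv_into UNIV f = (\<lambda>p. p + (- a))"
    by (rule inv_equality) (auto simp: f)
  then have "inv\<^bsub>GAL\<^esub> f = (\<lambda>p. p + (- a))"
    using inv_GAL[OF translation_in_GAL[of a]] by (simp add: f)
  then show "inv\<^bsub>GAL\<^esub> f \<in> spacetime_translations"
    unfolding spacetime_translations_eq by blast
next
  fix f g assume "f \<in> spacetime_translations" "g \<in> spacetime_translations"
  then show "f \<otimes>\<^bsub>GAL\<^esub> g \<in> spacetime_translations"
    by (auto simp: spacetime_translations_eq mult_GAL translation_in_GAL fun_eq_iff add.assoc)
qed (use generators_in_GAL in \<open>auto simp: spacetime_translations_eq\<close>)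

text \<open>Linear bijections are closed under composition and inversion. Hence homogeneous
  isometries fix the origin.\<close>

lemma homogeneous_linear:
  assumes "g \<in> generate GAL homogeneous_generators"
  shows "linear g"
  using assms
proof induction
  case one
  show ?case unfolding one_GAL by (rule linear_id)
next
  case (inv h)
  then have h: "linear h" "bij h" "h \<in> carrier GAL"
    using homogeneous_generators_linear homogeneous_generators_bij generators_in_GAL by auto
  then show ?case
    by (simp add: inv_GAL bij_is_inj inj_linear_imp_inv_linear)
next
  case (eng h1 h2)
  then have "h1 \<in> carrier GAL" "h2 \<in> carrier GAL"
    using subgroup.mem_carrier[OF subgroup_homogeneous] by auto
  with eng show ?case by (simp add: mult_GAL linear_compose[unfolded o_def] o_def)
qed (rule homogeneous_generators_linear)

text \<open>The generators and their inverses are linear or translations, and affine maps compose to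
  affine maps. The linear part \<open>l\<close> determines how an element conjugates
  translations.\<close>

lemma GAL_affine:
  assumes "g \<in> carrier GAL"
  obtains l c where "linear l" "\<And>p. g p = l p + c"
proof -
  from assms have "g \<in> generate GAL (homogeneous_generators \<union> spacetime_translations)"
    by (simp add: carrier_GAL_eq)
  then have "\<exists>l c. linear l \<and> g = (\<lambda>p. l p + c)"
  proof induction
    case one
    show ?case by (auto simp: one_GAL intro!: exI[of _ id] exI[of _ 0] linear_id)
  next
    case (incl h)
    show ?case
    proof (cases "h \<in> homogeneous_generators")
      case True
      then show ?thesis
        by (intro exI[of _ h] exI[of _ 0]) (simp add: homogeneous_generators_linear)
    next
      case False
      with incl obtain a where "h = (\<lambda>p. p + a)" by (auto simp: spacetime_translations_eq)
      then show ?thesis by (intro exI[of _ id] exI[of _ a]) (simp add: linear_id[unfolded id_def] id_def)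
    qed
  next
    case (inv h)
    show ?case
    proof (cases "h \<in> homogeneous_generators")
      case True
      then have "linear (inv\<^bsub>GAL\<^esub> h)"
        by (intro homogeneous_linear generate.inv)
      then show ?thesis by (intro exI[of _ "inv\<^bsub>GAL\<^esub> h"] exI[of _ 0]) simp
    next
      case False
      with inv have "inv\<^bsub>GAL\<^esub> h \<in> spacetime_translations"
        using subgroup.m_inv_closed[OF subgroup_translations] by blast
      then obtain a where "inv\<^bsub>GAL\<^esub> h = (\<lambda>p. p + a)" by (auto simp: spacetime_translations_eq)
      then show ?thesis by (intro exI[of _ id] exI[of _ a]) (simp add: linear_id[unfolded id_def] id_def)
    qed
  next
    case (eng h1 h2)
    then have "h1 \<in> carrier GAL" "h2 \<in> carrier GAL" by (simp_all add: carrier_GAL_eq)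
    moreover from eng.IH obtain l1 c1 l2 c2 where
      "linear l1" "h1 = (\<lambda>p. l1 p + c1)" "linear l2" "h2 = (\<lambda>p. l2 p + c2)" by blast
    ultimately show ?case
      \<comment> \<open>The witnesses come from expanding
        \<open>l1 (l2 p + c2) + c1\<close>.\<close>
      by (intro exI[of _ "l1 \<circ> l2"] exI[of _ "l1 c2 + c1"])
        (auto simp: mult_GAL linear_compose[unfolded o_def] o_def linear_add)
  qed
  then show thesis using that by blast
qed

lemma translations_normal: "spacetime_translations \<lhd> GAL"
proof (rule GAL.normal_invI[OF subgroup_translations])
  fix g f assume g: "g \<in> carrier GAL" and "f \<in> spacetime_translations"
  then obtain a where f: "f = (\<lambda>p. p + a)" by (auto simp: spacetime_translations_eq)
  obtain l c where l: "linear l" "\<And>p. g p = l p + c" using GAL_affine[OF g] by blast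
  \<comment> \<open>By linearity \<open>g (p + a) = g p + l a\<close>, so translating by
    \<open>a\<close> before \<open>g\<close> is translating by \<open>l a\<close> after it.
    Cancelling \<open>g\<close> then gives the conjugate.\<close>
  have "g \<otimes>\<^bsub>GAL\<^esub> f = (\<lambda>p. p + l a) \<otimes>\<^bsub>GAL\<^esub> g"
    using g by (simp add: f mult_GAL translation_in_GAL comp_def l(2) linear_add[OF l(1)] ac_simps)
  then have "g \<otimes>\<^bsub>GAL\<^esub> f \<otimes>\<^bsub>GAL\<^esub> inv\<^bsub>GAL\<^esub> g = (\<lambda>p. p + l a)"
    using g by (simp add: GAL.m_assoc translation_in_GAL)
  then show "g \<otimes>\<^bsub>GAL\<^esub> f \<otimes>\<^bsub>GAL\<^esub> inv\<^bsub>GAL\<^esub> g \<in> spacetime_translations"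
    by (auto simp: spacetime_translations_eq)
qed

section \<open>The splitting of \<open>GAL\<close>\<close>

interpretation GAL_split: internal_semidirect_product spacetime_translations GAL
  "generate GAL homogeneous_generators"
proof -
  interpret snd: second_isomorphism_grp spacetime_translations GAL
    "generate GAL homogeneous_generators"
    by (intro second_isomorphism_grp.intro second_isomorphism_grp_axioms.intro
        translations_normal subgroup_homogeneous)
  show "internal_semidirect_product spacetime_translations GAL
    (generate GAL homogeneous_generators)"
  proof
    have "f = \<one>\<^bsub>GAL\<^esub>" if f: "f \<in> spacetime_translations"
      "f \<in> generate GAL homogeneous_generators" for f
    proof -
      from f obtain a where a: "f = (\<lambda>p. p + a)" by (auto simp: spacetime_translations_eq)
      \<comment> \<open>The translation vector is the image of the origin, so it vanishes.\<close>
      have "f 0 = 0" using homogeneous_linear[OF f(2)] by (rule linear_0)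
      then show ?thesis by (auto simp: a one_GAL)
    qed
    then show "spacetime_translations \<inter> generate GAL homogeneous_generators = {\<one>\<^bsub>GAL\<^esub>}"
      using subgroup.one_closed[OF subgroup_translations] generate.one by auto
    \<comment> \<open>The set product with a normal factor is a subgroup; once it contains all
      generators it is the whole group.\<close>
    have "homogeneous_generators \<union> spacetime_translations
        \<subseteq> spacetime_translations <#>\<^bsub>GAL\<^esub> generate GAL homogeneous_generators"
      using snd.H_contained_in_set_mult snd.S_contained_in_set_mult
      by (auto intro: generate.incl)
    then have "carrier GAL \<subseteq> spacetime_translations <#>\<^bsub>GAL\<^esub> generate GAL homogeneous_generators"
      unfolding carrier_GAL_eq
      by (rule GAL.generate_subgroup_incl[OF _ snd.normal_set_mult_subgroup])
    then show "spacetime_translations <#>\<^bsub>GAL\<^esub> generate GAL homogeneous_generators = carrier GAL"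
      using subgroup.subset[OF snd.normal_set_mult_subgroup] by auto
  qed
qed

text \<open>In part (a) the homomorphism into \<open>AutoGroup\<close> ensures that the outer
  product is formed along an action by automorphisms; the isomorphism then identifies a pair with
  the product of its entries.\<close>

theorem theorem12:
  shows "(carrier Translation_group \<lhd> GAL
          \<and> subgroup (carrier Homogeneous_group) GAL
          \<and> conj_action GAL (carrier Translation_group)
              \<in> hom Homogeneous_group (AutoGroup Translation_group)
          \<and> (\<lambda>(\<tau>, l). \<tau> \<otimes>\<^bsub>GAL\<^esub> l)
              \<in> iso (semidirect_product Translation_group Homogeneous_group
                       (conj_action GAL (carrier Translation_group))) GAL)
       \<and> (\<forall>g. direct_isometry Homogeneous_group g \<longrightarrow> direct_isometry GAL g)
       \<and> (\<forall>g. indirect_isometry Homogeneous_group g \<longrightarrow> indirect_isometry GAL g)"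
proof -
  note defs = Translation_group_def Homogeneous_group_def
  have "carrier Translation_group \<lhd> GAL" "subgroup (carrier Homogeneous_group) GAL"
    using translations_normal subgroup_homogeneous by (simp_all add: defs)
  moreover have "conj_action GAL (carrier Translation_group)
      \<in> hom Homogeneous_group (AutoGroup Translation_group)"
    using GAL_split.conj_action_hom by (simp add: defs)
  moreover have "(\<lambda>(\<tau>, l). \<tau> \<otimes>\<^bsub>GAL\<^esub> l)
      \<in> iso (semidirect_product Translation_group Homogeneous_group
               (conj_action GAL (carrier Translation_group))) GAL"
    using GAL_split.semidirect_product_iso by (simp add: defs)
  moreover have "direct_isometry GAL g" if "direct_isometry Homogeneous_group g" for g
    using that direct_isometry_mono subgroup.subset[OF subgroup_homogeneous]
    by (simp add: Homogeneous_group_def)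
  \<comment> \<open>By contraposition: an element of the homogeneous group that is direct in
    \<open>GAL\<close> is direct already in the subgroup, by the retraction.\<close>
  moreover have "indirect_isometry GAL g" if "indirect_isometry Homogeneous_group g" for g
    using that GAL_split.direct_isometry_retract by (auto simp: Homogeneous_group_def indirect_isometry_def)
  ultimately show ?thesis by blast
qed

end
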